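(* Let $\mathcal{X}\subset\mathbb{R}$ be countably infinite and let $(\mathcal{Y}_x)_{x\in\mathcal{X}}$ be an independent family of random closed subsets of $\mathbb{R}$ with $P[\mathcal{Y}_x=\emptyset]=0$ for all $x\in\mathcal{X}$. Assume that each $\mathcal{Y}_x$ is first-order stationary, i.e. for all $x\in\mathcal{X}$ and all $a,b,c\in\mathbb{R}$ with $a\le b$, $P[\mathcal{Y}_x\cap[a+c,b+c]\neq\emptyset]=P[\mathcal{Y}_x\cap[a,b]\neq\emptyset]$. Let $D_x^+(0):=\inf\{y: y\ge 0,\ y\in\mathcal{Y}_x\}$ and let $M$ be the event that there exists an increasing and bounded function $f:\mathbb{R}\to\mathbb{R}$ with $f(x)\in\mathcal{Y}_x$ for all $x\in\mathcal{X}$. Then $P[M]=1$ if $\sum_{x\in\mathcal{X}}D_x^+(0)<\infty$ almost surely, and $P[M]=0$ otherwise.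
   Context: All random objects are defined on a complete probability space $(\Omega,\mathcal{F},P)$. A random closed set is a random variable with values in the space of closed subsets of $\mathbb{R}$, equipped with the Borel $\sigma$-algebra generated by the Fell topology. A function $f$ is called increasing if $f(s)\le f(t)$ for all $s<t$ (not necessarily strictly). Convention: $\inf\emptyset=\infty$. That $M\in\mathcal{F}$ follows from the completeness of the probability space and is part of the assertion. *)

theory Defs
  imports "HOL-Probability.Probability"
begin

text \<open>The Fell topology on the closed subsets of a topological space: the subbase consists of the
  classes of closed sets missing a given compact set and of those hitting a given open set.\<close>

definition fell_topology :: "'a::topological_space set topology" where
  "fell_topology = topology_generated_by
     ({{F. closed F \<and> F \<inter> K = {}} | K. compact K} \<union> {{F. closed F \<and> F \<inter> G \<noteq> {}} | G. open G})"

definition fell_borel :: "'a::topological_space set measure" where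
  "fell_borel = sigma {F. closed F} {U. openin fell_topology U}"

lemma openin_fell_miss:
  assumes "compact K"
  shows "openin fell_topology {F. closed F \<and> F \<inter> K = {}}"
  unfolding fell_topology_def
  by (rule topology_generated_by_Basis, rule UnI1, rule CollectI, rule exI, rule conjI[OF refl assms])

lemma topspace_fell_topology [simp]: "topspace fell_topology = {F. closed F}"
proof
  show "topspace fell_topology \<subseteq> {F. closed F}"
    unfolding fell_topology_def topology_generated_by_topspace
    by (intro Union_least, elim UnE CollectE exE conjE) (simp_all add: Collect_mono)
  show "{F. closed F} \<subseteq> topspace fell_topology"
    using openin_subset[OF openin_fell_miss[OF compact_empty]] by simp
qed

lemma openin_fell_topology_subset: "{U. openin fell_topology U} \<subseteq> Pow {F. closed F}"
proof (intro subsetI PowI)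
  fix U F assume "U \<in> {U. openin fell_topology U}" "F \<in> U"
  then show "F \<in> {F. closed F}"
    using openin_subset[of fell_topology U] unfolding topspace_fell_topology by blast
qed

lemma space_fell_borel [simp]: "space fell_borel = {F. closed F}"
  unfolding fell_borel_def by (rule space_measure_of[OF openin_fell_topology_subset])

lemma sets_fell_borel: "sets fell_borel = sigma_sets {F. closed F} {U. openin fell_topology U}"
  unfolding fell_borel_def by (rule sets_measure_of[OF openin_fell_topology_subset])

lemma fell_borel_miss_compact:
  assumes "compact K"
  shows "{F. closed F \<and> F \<inter> K = {}} \<in> sets fell_borel"
  unfolding sets_fell_borel by (rule sigma_sets.Basic, rule CollectI, rule openin_fell_miss[OF assms])

lemma fell_borel_hit_compact:
  assumes "compact K"
  shows "{F. closed F \<and> F \<inter> K \<noteq> {}} \<in> sets fell_borel"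
proof -
  have "{F. closed F \<and> F \<inter> K \<noteq> {}} = space fell_borel - {F. closed F \<and> F \<inter> K = {}}"
    by auto
  then show ?thesis
    using fell_borel_miss_compact[OF assms] by (simp only: sets.compl_sets)
qed

definition first_order_stationary :: "'w measure \<Rightarrow> ('w \<Rightarrow> real set) \<Rightarrow> bool" where
  "first_order_stationary P A \<longleftrightarrow>
     (\<forall>a b c. a \<le> b \<longrightarrow>
        measure P {w \<in> space P. A w \<inter> {a + c..b + c} \<noteq> {}} =
        measure P {w \<in> space P. A w \<inter> {a..b} \<noteq> {}})"

text \<open>The infimum is taken in \<^typ>\<open>ennreal\<close>, so it is infinite when \<open>A\<close> has no
  nonnegative element.\<close>

definition dist_right_of_zero :: "real set \<Rightarrow> ennreal" where
  "dist_right_of_zero A = Inf {ennreal y | y. y \<ge> 0 \<and> y \<in> A}"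

definition bounded_increasing_selection_event ::
    "'w measure \<Rightarrow> real set \<Rightarrow> (real \<Rightarrow> 'w \<Rightarrow> real set) \<Rightarrow> 'w set" where
  "bounded_increasing_selection_event P X Y =
     {w \<in> space P. \<exists>f :: real \<Rightarrow> real. mono f \<and> bounded (range f) \<and> (\<forall>x\<in>X. f x \<in> Y x w)}"

end

(* For a finite F \<subseteq> X and a start t, pick greedily from left to right the smallest
   admissible value: this gives the minimal increasing selection over F with values \<ge> t. By
   independence and stationarity each jump is an independent copy of D_x^+(0), so the total height
   has the law of the finite sum of the D_x^+(0), whatever t is. Along finite sets exhausting X the
   minimal selections increase; they converge to a selection on X iff their heights stay bounded, and
   every bounded selection with values \<ge> -k dominates those started at -k. So M is the union over
   k of events that all have probability P[sum of D_x^+(0) < infinity], which is 0 or 1 by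
   Kolmogorov's law. *)

theory Submission
  imports Defs
begin

section \<open>Minimal increasing selections\<close>

text \<open>Heights are measured from the start \<open>t\<close> in \<open>ennreal\<close>, so an
  empty set of candidates gives \<infinity>. As \<open>ennreal\<close> sends negative numbers to 0,
  \<open>t \<le> y\<close> has to be demanded separately for \<open>s = 0\<close>.\<close>

definition next_dist :: "real \<Rightarrow> real set \<Rightarrow> ennreal \<Rightarrow> ennreal" where
  "next_dist t A s = Inf {ennreal (y - t) | y. y \<in> A \<and> t \<le> y \<and> s \<le> ennreal (y - t)}"

text \<open>This is the greedy value at the last point of \<open>F\<close>, less \<open>t\<close>.
  By \<open>next_dist_ge\<close> it stays \<infinity> once some point has no admissible
  value.\<close>

definition selection_height :: "real \<Rightarrow> (real \<Rightarrow> real set) \<Rightarrow> real set \<Rightarrow> ennreal" where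
  "selection_height t A F = foldl (\<lambda>s x. next_dist t (A x) s) 0 (sorted_list_of_set F)"

lemma dist_right_of_zero_eq_next_dist: "dist_right_of_zero A = next_dist 0 A 0"
  unfolding dist_right_of_zero_def next_dist_def by (rule arg_cong[where f = Inf]) auto

lemma next_dist_ge: "s \<le> next_dist t A s"
  unfolding next_dist_def by (auto intro!: Inf_greatest)

lemma next_dist_mono: "s \<le> s' \<Longrightarrow> next_dist t A s \<le> next_dist t A s'"
  unfolding next_dist_def by (intro Inf_superset_mono) auto

lemma next_dist_le: "y \<in> A \<Longrightarrow> t \<le> y \<Longrightarrow> s \<le> ennreal (y - t) \<Longrightarrow> next_dist t A s \<le> ennreal (y - t)"
  unfolding next_dist_def by (auto intro!: Inf_lower)

text \<open>A nonempty closed set that is bounded below contains its infimum, and finiteness of the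
  distance means that candidates exist.\<close>

lemma next_dist_attained:
  assumes "closed A" "next_dist t A s < \<infinity>"
  obtains y where "y \<in> A" "t \<le> y" "s \<le> ennreal (y - t)" "next_dist t A s = ennreal (y - t)"
proof -
  define Z where "Z = {y. y \<in> A \<and> t \<le> y \<and> s \<le> ennreal (y - t)}"
  have Z_eq: "next_dist t A s = Inf ((\<lambda>y. ennreal (y - t)) ` Z)"
    unfolding next_dist_def Z_def by (rule arg_cong[where f = Inf]) auto
  have ne: "Z \<noteq> {}"
    using assms(2) Z_eq by auto
  have bdd: "bdd_below Z"
    unfolding Z_def by (rule bdd_belowI[of _ t]) auto
  have "closed ((\<lambda>y. ennreal (y - t)) -` {s..})"
    by (intro closed_vimage continuous_on_ennreal continuous_intros closed_atLeast)
  then have "closed (A \<inter> {t..} \<inter> (\<lambda>y. ennreal (y - t)) -` {s..})"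
    using assms(1) by (intro closed_Int) auto
  also have "A \<inter> {t..} \<inter> (\<lambda>y. ennreal (y - t)) -` {s..} = Z"
    unfolding Z_def by auto
  finally have "closed Z" .
  then have "Inf Z \<in> Z"
    using ne bdd by (intro closed_contains_Inf)
  moreover have "next_dist t A s = ennreal (Inf Z - t)"
  proof (rule antisym)
    show "next_dist t A s \<le> ennreal (Inf Z - t)"
      unfolding Z_eq using \<open>Inf Z \<in> Z\<close> by (intro INF_lower)
    show "ennreal (Inf Z - t) \<le> next_dist t A s"
      unfolding Z_eq
      by (intro INF_greatest ennreal_leI) (simp add: bdd cInf_lower)
  qed
  ultimately show thesis
    using that[of "Inf Z"] unfolding Z_def by blast
qed

text \<open>Turns distances into hitting events of compact intervals, the form in which stationarity
  and Fell measurability apply. The forward direction rests on the infimum being attained.\<close>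

lemma next_dist_le_iff:
  assumes "closed A" "0 \<le> u" "0 \<le> s"
  shows "next_dist t A (ennreal s) \<le> ennreal u \<longleftrightarrow> A \<inter> {t + s..t + u} \<noteq> {}"
proof
  assume le: "next_dist t A (ennreal s) \<le> ennreal u"
  then have "next_dist t A (ennreal s) < \<infinity>"
    using ennreal_less_top le_less_trans by fastforce
  then obtain y where "y \<in> A" "t \<le> y" "ennreal s \<le> ennreal (y - t)"
      "next_dist t A (ennreal s) = ennreal (y - t)"
    using next_dist_attained[OF assms(1)] by blast
  then have "y \<in> A \<inter> {t + s..t + u}"
    using le assms by auto
  then show "A \<inter> {t + s..t + u} \<noteq> {}" by blast
next
  assume "A \<inter> {t + s..t + u} \<noteq> {}"
  then obtain y where y: "y \<in> A" "t + s \<le> y" "y \<le> t + u" by auto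
  then have "next_dist t A (ennreal s) \<le> ennreal (y - t)"
    using assms by (intro next_dist_le) (auto intro: ennreal_leI)
  also have "\<dots> \<le> ennreal u"
    using y by (intro ennreal_leI) auto
  finally show "next_dist t A (ennreal s) \<le> ennreal u" .
qed

text \<open>Only the distances at rational positions enter, which yields joint measurability.\<close>

lemma next_dist_le_iff_rational:
  assumes "closed A" "0 \<le> u"
  shows "next_dist t A s \<le> ennreal u \<longleftrightarrow>
    s \<le> ennreal u \<and> (\<forall>q\<in>\<rat>. 0 \<le> q \<and> ennreal q \<le> s \<longrightarrow> A \<inter> {t + q..t + u} \<noteq> {})"
    (is "?L \<longleftrightarrow> ?R")
proof
  assume le: ?L
  have "A \<inter> {t + q..t + u} \<noteq> {}" if "0 \<le> q" "ennreal q \<le> s" for q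
    using order_trans[OF next_dist_mono[OF that(2)] le] next_dist_le_iff[OF assms that(1)] by blast
  then show ?R
    using order_trans[OF next_dist_ge le] by blast
next
  assume R: ?R
  then obtain s' where s': "s = ennreal s'" "0 \<le> s'" "s' \<le> u"
    using assms(2) by (cases s) (auto simp: top_unique)
  \<comment> \<open>The largest point of \<open>A\<close> up to \<open>t + u\<close> is the only
    candidate to test: it is at least \<open>t + q\<close> for every rational \<open>q\<close> in
    \<open>{0..s'}\<close>, hence at least \<open>t + s'\<close> by density.\<close>
  define m where "m = Sup (A \<inter> {..t + u})"
  have hit: "A \<inter> {t + q..t + u} \<noteq> {}" if "q \<in> \<rat>" "0 \<le> q" "q \<le> s'" for q
    using R that s' by (auto intro: ennreal_leI)
  have ne: "A \<inter> {..t + u} \<noteq> {}"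
    using hit[of 0] s' by auto
  have bdd: "bdd_above (A \<inter> {..t + u})" by auto
  have m: "m \<in> A \<inter> {..t + u}"
    unfolding m_def using assms ne bdd by (intro closed_contains_Sup) auto
  have ge: "t + q \<le> m" if q: "q \<in> \<rat>" "0 \<le> q" "q \<le> s'" for q
  proof -
    obtain y where "y \<in> A" "t + q \<le> y" "y \<le> t + u"
      using hit[OF q] by auto
    then show ?thesis
      unfolding m_def by (intro cSup_upper2[OF _ _ bdd, of y]) auto
  qed
  have "s' \<le> m - t"
  proof (rule ccontr)
    assume "\<not> s' \<le> m - t"
    moreover have "0 \<le> m - t"
      using ge[of 0] s' by auto
    ultimately obtain q where "q \<in> \<rat>" "m - t < q" "q < s'"
      using Rats_dense_in_real by (metis not_le)
    then show False
      using ge[of q] \<open>0 \<le> m - t\<close> by auto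
  qed
  then have "m \<in> A \<inter> {t + s'..t + u}"
    using m by auto
  then show ?L
    unfolding s'(1) next_dist_le_iff[OF assms s'(2)] by blast
qed

section \<open>Greedy heights over finite index sets\<close>

lemma selection_height_empty [simp]: "selection_height t A {} = 0"
  by (simp add: selection_height_def)

lemma selection_height_insert_max:
  assumes "finite F" "\<forall>a\<in>F. a < x"
  shows "selection_height t A (insert x F) = next_dist t (A x) (selection_height t A F)"
proof -
  have "sorted_list_of_set (insert x F) = sorted_list_of_set F @ [x]"
  proof (rule sorted_distinct_set_unique)
    show "set (sorted_list_of_set (insert x F)) = set (sorted_list_of_set F @ [x])"
      using assms(1) by (subst set_sorted_list_of_set) auto
  qed (use assms in \<open>auto simp: sorted_append simp del: sorted_list_of_set_insert_remove intro: less_imp_le\<close>)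
  then show ?thesis
    by (simp add: selection_height_def)
qed

lemma selection_height_cong:
  "finite F \<Longrightarrow> (\<And>x. x \<in> F \<Longrightarrow> A x = B x) \<Longrightarrow> selection_height t A F = selection_height t B F"
  by (induction F rule: finite_linorder_max_induct) (auto simp: selection_height_insert_max)

text \<open>Remove the largest point \<open>b\<close> of the bigger set from both sets. If
  \<open>F\<close> contains \<open>b\<close>, both sides take the same monotone step; otherwise only
  the right side takes a step, which cannot lower it.\<close>

lemma selection_height_mono:
  assumes "finite G" "F \<subseteq> G"
  shows "selection_height t A F \<le> selection_height t A G"
  using assms
proof (induction G arbitrary: F rule: finite_linorder_max_induct)
  case empty
  then show ?case by auto
next
  case (insert b G)
  have le: "selection_height t A (F - {b}) \<le> selection_height t A G"
    using insert.prems by (intro insert.IH) auto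
  show ?case
  proof (cases "b \<in> F")
    case True
    have "finite (F - {b})" "\<forall>a\<in>F - {b}. a < b"
      using insert.prems insert.hyps by (auto dest: finite_subset)
    then have "selection_height t A (insert b (F - {b}))
        = next_dist t (A b) (selection_height t A (F - {b}))"
      by (rule selection_height_insert_max)
    then show ?thesis
      using True le insert.hyps
      by (simp add: insert_absorb selection_height_insert_max next_dist_mono)
  next
    case False
    then show ?thesis
      using le insert.hyps order_trans[OF le next_dist_ge]
      by (simp add: selection_height_insert_max)
  qed
qed

text \<open>Minimality of the greedy selection. The bound \<open>c\<close> is left arbitrary in the
  induction so that it can be lowered to \<open>f b\<close> for the points before
  \<open>b\<close>.\<close>

lemma selection_height_le:
  assumes "finite F" "mono_on F f" "\<And>x. x \<in> F \<Longrightarrow> f x \<in> A x" "\<And>x. x \<in> F \<Longrightarrow> t \<le> f x"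
    "\<And>x. x \<in> F \<Longrightarrow> f x \<le> c"
  shows "selection_height t A F \<le> ennreal (c - t)"
  using assms
proof (induction F arbitrary: c rule: finite_linorder_max_induct)
  case empty
  then show ?case by simp
next
  case (insert b F)
  have "f a \<le> f b" if "a \<in> F" for a
    using insert.prems(1) insert.hyps that by (intro mono_onD[of "insert b F" f]) auto
  then have "selection_height t A F \<le> ennreal (f b - t)"
    using insert.prems(2,3) mono_on_subset[OF insert.prems(1)] by (intro insert.IH) auto
  then have "selection_height t A (insert b F) \<le> ennreal (f b - t)"
    using insert.prems insert.hyps by (simp only: selection_height_insert_max) (intro next_dist_le, auto)
  also have "\<dots> \<le> ennreal (c - t)"
    using insert.prems by (auto intro: ennreal_leI)
  finally show ?case .
qed

text \<open>Stopping the greedy choice at \<open>x\<close> shows the value chosen there, so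
  \<open>t\<close> plus this height is a genuine point of \<open>A x\<close>.\<close>

lemma selection_height_initial_segment:
  assumes "finite F" "x \<in> F" "closed (A x)" "selection_height t A F < \<infinity>"
  obtains y where "y \<in> A x" "t \<le> y" "selection_height t A {a \<in> F. a \<le> x} = ennreal (y - t)"
proof -
  have eq: "{a \<in> F. a \<le> x} = insert x {a \<in> F. a < x}"
    using assms by auto
  have step: "selection_height t A {a \<in> F. a \<le> x}
      = next_dist t (A x) (selection_height t A {a \<in> F. a < x})"
    unfolding eq using assms(1) by (intro selection_height_insert_max) auto
  have "selection_height t A {a \<in> F. a \<le> x} < \<infinity>"
    using selection_height_mono[OF assms(1), of "{a \<in> F. a \<le> x}"] assms(4)
    by (auto intro: le_less_trans)
  then have "next_dist t (A x) (selection_height t A {a \<in> F. a < x}) < \<infinity>"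
    unfolding step .
  with assms(3) obtain y where "y \<in> A x" "t \<le> y"
      "next_dist t (A x) (selection_height t A {a \<in> F. a < x}) = ennreal (y - t)"
    by (rule next_dist_attained)
  then show thesis
    by (intro that) (simp_all add: step)
qed

text \<open>The limit of the minimal selections along the exhausting sets \<open>F n\<close> is a selection
  on the whole of \<open>X\<close>; it is bounded because the heights are.\<close>

lemma increasing_selection_if_bounded_height:
  assumes X: "X = (\<Union>n. F n)" and F: "incseq F" "\<And>n. finite (F n)"
    and cl: "\<And>x. x \<in> X \<Longrightarrow> closed (A x)"
    and fin: "(SUP n. selection_height t A (F n)) < \<infinity>"
  obtains f :: "real \<Rightarrow> real" where "mono f" "bounded (range f)" "\<forall>x\<in>X. f x \<in> A x"
proof -
  \<comment> \<open>Cutting \<open>F n\<close> at \<open>x\<close> defines the limit for every real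
    \<open>x\<close>, not just on \<open>X\<close>, and makes it increasing in
    \<open>x\<close>.\<close>
  define g where "g x = (SUP n. selection_height t A {a \<in> F n. a \<le> x})" for x
  define f where "f x = t + enn2real (g x)" for x
  define C where "C = (SUP n. selection_height t A (F n))"
  have g_le: "g x \<le> C" for x
    unfolding g_def C_def using F by (intro SUP_mono' selection_height_mono) auto
  have C: "C < \<infinity>" using fin unfolding C_def .
  have g_fin: "g x < \<infinity>" for x using g_le C by (rule le_less_trans)
  have g_mono: "g x \<le> g y" if "x \<le> y" for x y
    unfolding g_def using F that by (intro SUP_mono' selection_height_mono) auto
  have "mono f"
    unfolding f_def using g_mono g_fin by (intro monoI) (auto intro: enn2real_mono)
  moreover have "bounded (range f)"
  proof (rule boundedI[where B = "\<bar>t\<bar> + enn2real C"])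
    fix y assume "y \<in> range f"
    then obtain x where "y = t + enn2real (g x)" by (auto simp: f_def)
    moreover have "enn2real (g x) \<le> enn2real C"
      using g_le C by (auto intro: enn2real_mono)
    moreover have "0 \<le> enn2real (g x)"
      by (rule enn2real_nonneg)
    ultimately show "norm y \<le> \<bar>t\<bar> + enn2real C"
      unfolding real_norm_def by linarith
  qed
  moreover have "f x \<in> A x" if x: "x \<in> X" for x
  proof -
    obtain N where N: "x \<in> F N" using x X by auto
    \<comment> \<open>After the shift by \<open>N\<close> every index set contains \<open>x\<close>,
      so each \<open>t + enn2real (h n)\<close> lies in \<open>A x\<close>, and closedness passes
      this to the limit.\<close>
    define h where "h n = selection_height t A {a \<in> F (n + N). a \<le> x}" for n
    have inc: "incseq (\<lambda>n. selection_height t A {a \<in> F n. a \<le> x})"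
      using F by (intro incseq_SucI selection_height_mono) (auto dest: incseq_SucD)
    have "(\<lambda>n. selection_height t A {a \<in> F n. a \<le> x}) \<longlonglongrightarrow> g x"
      unfolding g_def using inc by (rule LIMSEQ_SUP)
    then have "h \<longlonglongrightarrow> g x"
      unfolding h_def by (rule LIMSEQ_ignore_initial_segment)
    then have lim: "(\<lambda>n. t + enn2real (h n)) \<longlonglongrightarrow> f x"
      unfolding f_def using g_fin[of x] by (intro tendsto_intros tendsto_enn2real) auto
    have "t + enn2real (h n) \<in> A x" for n
    proof -
      have "x \<in> F (n + N)"
        using N F(1) by (auto dest: incseqD[of F N "n + N"])
      moreover have "selection_height t A (F (n + N)) < \<infinity>"
        using fin by (rule le_less_trans[OF SUP_upper, rotated]) simp
      ultimately obtain y where "y \<in> A x" "t \<le> y" "h n = ennreal (y - t)"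
        unfolding h_def using selection_height_initial_segment[of "F (n + N)" x A t, OF F(2) _ cl[OF x]] by blast
      then show ?thesis by simp
    qed
    then show ?thesis
      using cl[OF x] lim closed_sequentially[of "A x" "\<lambda>n. t + enn2real (h n)"] by blast
  qed
  ultimately show thesis using that by blast
qed

text \<open>A bounded selection has some integer lower bound \<open>- real k\<close>, and by
  minimality the greedy heights started there stay bounded. Countably many starts therefore
  suffice.\<close>

lemma bounded_increasing_selection_iff:
  assumes "X = (\<Union>n. F n)" "incseq F" "\<And>n. finite (F n)" "\<And>x. x \<in> X \<Longrightarrow> closed (A x)"
  shows "(\<exists>f :: real \<Rightarrow> real. mono f \<and> bounded (range f) \<and> (\<forall>x\<in>X. f x \<in> A x)) \<longleftrightarrow>
    (\<exists>k :: nat. (SUP n. selection_height (- real k) A (F n)) < \<infinity>)" (is "?L \<longleftrightarrow> ?R")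
proof
  assume ?R
  then obtain k :: nat where "(SUP n. selection_height (- real k) A (F n)) < \<infinity>" ..
  with assms obtain f :: "real \<Rightarrow> real" where "mono f" "bounded (range f)" "\<forall>x\<in>X. f x \<in> A x"
    by (rule increasing_selection_if_bounded_height)
  then show ?L by blast
next
  assume ?L
  then obtain f :: "real \<Rightarrow> real"
    where f: "mono f" "bounded (range f)" "\<forall>x\<in>X. f x \<in> A x" by blast
  then obtain B where B: "\<And>x. \<bar>f x\<bar> \<le> B"
    unfolding bounded_iff by auto
  obtain k :: nat where k: "B \<le> real k" using real_arch_simple by blast
  have "selection_height (- real k) A (F n) \<le> ennreal (B - (- real k))" for n
  proof (rule selection_height_le[where f = f])
    show "mono_on (F n) f"
      using f(1) by (auto intro: mono_onI dest: monoD)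
    show "- real k \<le> f x" "f x \<le> B" if "x \<in> F n" for x
      using B[of x] k by (auto simp: abs_le_iff)
    show "f x \<in> A x" if "x \<in> F n" for x
      using f(3) that assms(1) by auto
  qed (rule assms(3))
  then have "(SUP n. selection_height (- real k) A (F n)) \<le> ennreal (B + real k)"
    by (intro SUP_least) auto
  also have "\<dots> < \<infinity>"
    by simp
  finally show ?R ..
qed


section \<open>Laws of the minimal selections\<close>

lemma borel_Iic: "borel = sigma UNIV (range (\<lambda>x::'a::{linorder_topology, second_countable_topology}. {..x}))"
proof (safe intro!: borel_eq_sigmaI1[OF borel_Ioi])
  fix x :: 'a
  have eq: "{x<..} = space (sigma UNIV (range atMost)) - {..x}"
    by auto
  show "{x<..} \<in> sets (sigma UNIV (range atMost))"
    unfolding eq by (intro sets.compl_sets) auto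
qed auto

lemma measure_ennreal_eqI_atMost:
  fixes M N :: "ennreal measure"
  assumes "finite_measure M" "sets M = sets borel" "sets N = sets borel"
    and "\<And>u. emeasure M {..u} = emeasure N {..u}"
  shows "M = N"
\<comment> \<open>The rays are stable under intersection, and \<open>{..top}\<close> is the whole
  space, so a constant sequence of finite mass serves as exhaustion.\<close>
proof (rule measure_eqI_generator_eq[where \<Omega> = UNIV and E = "range atMost" and A = "\<lambda>_. {..top}"])
  show "Int_stable (range (atMost :: ennreal \<Rightarrow> _))"
    by (auto simp: Int_stable_def)
  show "sets M = sigma_sets UNIV (range atMost)" "sets N = sigma_sets UNIV (range atMost)"
    unfolding assms(2,3) by (subst borel_Iic, simp)+
  show "emeasure M {..top} \<noteq> \<infinity>" for i :: nat
    using finite_measure.emeasure_finite[OF assms(1)] by simp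
qed (use assms(4) in auto)

lemma closed_if_measurable_fell_borel: "Z \<in> N \<rightarrow>\<^sub>M fell_borel \<Longrightarrow> w \<in> space N \<Longrightarrow> closed (Z w)"
  using measurable_space[of Z N fell_borel w] by simp

lemma next_dist_measurable [measurable]:
  "(\<lambda>p. next_dist t (snd p) (fst p)) \<in> borel_measurable (borel \<Otimes>\<^sub>M fell_borel)"
proof (rule borel_measurableI_le)
  fix u :: ennreal
  let ?B = "borel \<Otimes>\<^sub>M fell_borel :: (ennreal \<times> real set) measure"
  show "{p \<in> space ?B. next_dist t (snd p) (fst p) \<le> u} \<in> sets ?B"
  proof (cases u)
    case (real r)
    define H where "H q = {F. closed F \<and> F \<inter> {t + q..t + r} \<noteq> {}}" for q
    have H [measurable]: "H q \<in> sets fell_borel" for q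
      unfolding H_def by (intro fell_borel_hit_compact compact_Icc)
    have [measurable]: "countable \<rat>" by (rule countable_rat)
    \<comment> \<open>The sublevel set becomes a countable intersection of conditions, each
      involving the height and one Fell hitting event.\<close>
    have "{p \<in> space ?B. next_dist t (snd p) (fst p) \<le> u} = {p \<in> space ?B.
        fst p \<le> u \<and> (\<forall>q\<in>\<rat>. 0 \<le> q \<and> ennreal q \<le> fst p \<longrightarrow> snd p \<in> H q)}"
      using real next_dist_le_iff_rational[of _ r t]
      by (intro Collect_cong conj_cong refl) (auto simp: space_pair_measure H_def)
    also have "\<dots> \<in> sets ?B"
      by measurable
    finally show ?thesis .
  qed simp
qed

lemma measurable_next_dist_comp [measurable (raw)]:
  assumes "S \<in> borel_measurable N" "Z \<in> N \<rightarrow>\<^sub>M fell_borel"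
  shows "(\<lambda>w. next_dist t (Z w) (S w)) \<in> borel_measurable N"
  using measurable_compose[OF measurable_Pair[OF assms] next_dist_measurable] by simp

lemma measurable_dist_right_of_zero [measurable]:
  "dist_right_of_zero \<in> borel_measurable fell_borel"
  unfolding dist_right_of_zero_eq_next_dist by measurable

lemma measurable_selection_height:
  assumes "finite F" "\<And>x. x \<in> F \<Longrightarrow> Z x \<in> N \<rightarrow>\<^sub>M fell_borel"
  shows "(\<lambda>w. selection_height t (\<lambda>x. Z x w) F) \<in> borel_measurable N"
  using assms
  by (induction F rule: finite_linorder_max_induct)
    (auto simp: selection_height_insert_max intro!: measurable_next_dist_comp)

section \<open>Comparison in law with sums of independent distances\<close>

context prob_space
begin

text \<open>For \<open>s = a\<close> and \<open>u = b\<close> the two distribution functions are the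
  probabilities of hitting \<open>{t + a..t + b}\<close> and \<open>{0..b - a}\<close>, which agree
  by stationarity.\<close>

lemma distr_next_dist:
  assumes Y [measurable]: "Y \<in> M \<rightarrow>\<^sub>M fell_borel" and stat: "first_order_stationary M Y"
  shows "distr M borel (\<lambda>w. next_dist t (Y w) s) = distr M borel (\<lambda>w. s + dist_right_of_zero (Y w))"
proof (rule measure_ennreal_eqI_atMost)
  show "finite_measure (distr M borel (\<lambda>w. next_dist t (Y w) s))"
    by (intro finite_measure_distr) measurable
  fix u :: ennreal
  have cl: "closed (Y w)" if "w \<in> space M" for w
    using closed_if_measurable_fell_borel[OF Y that] .
  have "emeasure M {w \<in> space M. next_dist t (Y w) s \<le> u}
      = emeasure M {w \<in> space M. s + dist_right_of_zero (Y w) \<le> u}"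
  proof (cases "s \<le> u \<and> u < \<infinity>")
    case True
    then obtain a b where ab: "s = ennreal a" "u = ennreal b" "0 \<le> a" "a \<le> b"
      by (cases s; cases u) (auto simp: top_unique)
    have "next_dist t (Y w) s \<le> u \<longleftrightarrow> Y w \<inter> {0 + (t + a)..(b - a) + (t + a)} \<noteq> {}"
      if "w \<in> space M" for w
      using next_dist_le_iff[OF cl[OF that], of b a t] ab by (simp add: add.commute)
    moreover have "s + dist_right_of_zero (Y w) \<le> u \<longleftrightarrow> Y w \<inter> {0..b - a} \<noteq> {}"
      if "w \<in> space M" for w
    proof -
      have "u = s + ennreal (b - a)"
        using ab by (simp flip: ennreal_plus)
      then have "s + dist_right_of_zero (Y w) \<le> u \<longleftrightarrow> dist_right_of_zero (Y w) \<le> ennreal (b - a)"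
        using ab by simp
      then show ?thesis
        using next_dist_le_iff[OF cl[OF that], of "b - a" 0 0] ab
        by (simp add: dist_right_of_zero_eq_next_dist)
    qed
    ultimately show ?thesis
      using stat[unfolded first_order_stationary_def, rule_format, of 0 "b - a" "t + a"] ab
      by (simp add: emeasure_eq_measure cong: conj_cong)
  next
    \<comment> \<open>Either \<open>u\<close> is infinite and both events are certain, or
      \<open>u < s\<close> and both are empty, as both variables are at least
      \<open>s\<close>.\<close>
    case False
    then show ?thesis
    proof (cases "u = \<infinity>")
      case False
      with \<open>\<not> (s \<le> u \<and> u < \<infinity>)\<close> have "\<not> s \<le> u"
        by (auto simp: less_top)
      moreover have "s \<le> next_dist t A s" "s \<le> s + dist_right_of_zero A" for A
        by (auto intro: next_dist_ge)
      ultimately have "\<not> next_dist t A s \<le> u" "\<not> s + dist_right_of_zero A \<le> u" for A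
        by (meson order_trans)+
      then show ?thesis by simp
    qed simp
  qed
  then show "emeasure (distr M borel (\<lambda>w. next_dist t (Y w) s)) {..u}
      = emeasure (distr M borel (\<lambda>w. s + dist_right_of_zero (Y w))) {..u}"
    by (simp add: emeasure_distr vimage_def Int_def conj_commute)
qed simp_all


text \<open>By Fubini the image law is the mixture over \<open>N\<close> of the laws of the
  sections, so equality may be checked with the first coordinate frozen.\<close>

lemma distr_pair_cong:
  fixes f g :: "'b \<times> 'c \<Rightarrow> 'd"
  assumes "prob_space K" and f [measurable]: "f \<in> N \<Otimes>\<^sub>M K \<rightarrow>\<^sub>M L" and g [measurable]: "g \<in> N \<Otimes>\<^sub>M K \<rightarrow>\<^sub>M L"
    and eq: "\<And>s. s \<in> space N \<Longrightarrow> distr K L (\<lambda>z. f (s, z)) = distr K L (\<lambda>z. g (s, z))"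
  shows "distr (N \<Otimes>\<^sub>M K) L f = distr (N \<Otimes>\<^sub>M K) L g"
proof (rule measure_eqI)
  interpret K: prob_space K by fact
  fix B assume "B \<in> sets (distr (N \<Otimes>\<^sub>M K) L f)"
  then have B [measurable]: "B \<in> sets L" by simp
  have section_eq: "emeasure (distr (N \<Otimes>\<^sub>M K) L h) B = (\<integral>\<^sup>+s. emeasure (distr K L (\<lambda>z. h (s, z))) B \<partial>N)"
    if h [measurable]: "h \<in> N \<Otimes>\<^sub>M K \<rightarrow>\<^sub>M L" for h
  proof -
    have "emeasure (distr (N \<Otimes>\<^sub>M K) L h) B = emeasure (N \<Otimes>\<^sub>M K) (h -` B \<inter> space (N \<Otimes>\<^sub>M K))"
      by (rule emeasure_distr) measurable
    also have "\<dots> = (\<integral>\<^sup>+s. emeasure K (Pair s -` (h -` B \<inter> space (N \<Otimes>\<^sub>M K))) \<partial>N)"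
      by (rule K.emeasure_pair_measure_alt) measurable
    also have "\<dots> = (\<integral>\<^sup>+s. emeasure (distr K L (\<lambda>z. h (s, z))) B \<partial>N)"
      by (intro nn_integral_cong)
        (auto simp: emeasure_distr space_pair_measure intro!: arg_cong[where f = "emeasure K"])
    finally show ?thesis .
  qed
  show "emeasure (distr (N \<Otimes>\<^sub>M K) L f) B = emeasure (distr (N \<Otimes>\<^sub>M K) L g) B"
    unfolding section_eq[OF f] section_eq[OF g] by (intro nn_integral_cong) (simp add: eq)
qed simp

text \<open>\<^const>\<open>indep_var\<close> requires both variables to have the same type, so the independence of
  variables with different types is expressed by their joint law.\<close>

lemma distr_pair_indep_compose:
  assumes ind: "indep_var N A N' B" and f [measurable]: "f \<in> N \<rightarrow>\<^sub>M S" and g [measurable]: "g \<in> N' \<rightarrow>\<^sub>M T"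
  shows "distr M (S \<Otimes>\<^sub>M T) (\<lambda>w. (f (A w), g (B w)))
    = distr M S (\<lambda>w. f (A w)) \<Otimes>\<^sub>M distr M T (\<lambda>w. g (B w))"
proof -
  have [measurable]: "A \<in> M \<rightarrow>\<^sub>M N" "B \<in> M \<rightarrow>\<^sub>M N'"
    and joint: "distr M N A \<Otimes>\<^sub>M distr M N' B = distr M (N \<Otimes>\<^sub>M N') (\<lambda>w. (A w, B w))"
    using ind unfolding indep_var_distribution_eq by auto
  have "prob_space (distr (distr M N' B) T g)"
    by (intro prob_space.prob_space_distr prob_space_distr) measurable
  then have "sigma_finite_measure (distr (distr M N' B) T g)"
    by (rule prob_space_imp_sigma_finite)
  then have "distr (distr M N A) S f \<Otimes>\<^sub>M distr (distr M N' B) T g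
      = distr (distr M N A \<Otimes>\<^sub>M distr M N' B) (S \<Otimes>\<^sub>M T) (\<lambda>(x, y). (f x, g y))"
    by (intro pair_measure_distr) measurable
  also have "\<dots> = distr M (S \<Otimes>\<^sub>M T) (\<lambda>w. (f (A w), g (B w)))"
    unfolding joint by (subst distr_distr) (auto simp: comp_def)
  finally show ?thesis
    by (simp add: distr_distr comp_def)
qed

text \<open>Conditionally on the height reached so far, stationarity turns the next distance into an
  independent copy of the distance from zero.\<close>

lemma distr_next_dist_indep:
  assumes rv [measurable]: "S \<in> borel_measurable M" "S' \<in> borel_measurable M" "Z \<in> M \<rightarrow>\<^sub>M fell_borel"
    and joint: "distr M (borel \<Otimes>\<^sub>M fell_borel) (\<lambda>w. (S w, Z w)) = distr M borel S \<Otimes>\<^sub>M distr M fell_borel Z"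
      "distr M (borel \<Otimes>\<^sub>M fell_borel) (\<lambda>w. (S' w, Z w)) = distr M borel S' \<Otimes>\<^sub>M distr M fell_borel Z"
    and law: "distr M borel S = distr M borel S'"
    and stat: "first_order_stationary M Z"
  shows "distr M borel (\<lambda>w. next_dist t (Z w) (S w))
    = distr M borel (\<lambda>w. S' w + dist_right_of_zero (Z w))"
proof -
  define f where "f p = next_dist t (snd p) (fst p)" for p
  define g where "g p = fst p + dist_right_of_zero (snd p)" for p
  have [measurable]: "f \<in> borel_measurable (borel \<Otimes>\<^sub>M fell_borel)" "g \<in> borel_measurable (borel \<Otimes>\<^sub>M fell_borel)"
    unfolding f_def g_def by measurable
  have "distr M borel (\<lambda>w. next_dist t (Z w) (S w))
      = distr (distr M (borel \<Otimes>\<^sub>M fell_borel) (\<lambda>w. (S w, Z w))) borel f"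
    by (subst distr_distr) (auto simp: f_def comp_def)
  also have "\<dots> = distr (distr M borel S \<Otimes>\<^sub>M distr M fell_borel Z) borel f"
    by (simp only: joint)
  also have "\<dots> = distr (distr M borel S \<Otimes>\<^sub>M distr M fell_borel Z) borel g"
  proof (rule distr_pair_cong)
    show "prob_space (distr M fell_borel Z)"
      by (intro prob_space_distr) measurable
    show "distr (distr M fell_borel Z) borel (\<lambda>z. f (s, z)) = distr (distr M fell_borel Z) borel (\<lambda>z. g (s, z))" for s
      using distr_next_dist[OF rv(3) stat, of t s]
      by (simp add: distr_distr comp_def f_def g_def)
  qed simp_all
  also have "\<dots> = distr (distr M (borel \<Otimes>\<^sub>M fell_borel) (\<lambda>w. (S' w, Z w))) borel g"
    by (simp only: joint law)
  also have "\<dots> = distr M borel (\<lambda>w. S' w + dist_right_of_zero (Z w))"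
    by (subst distr_distr) (auto simp: g_def comp_def)
  finally show ?thesis .
qed

text \<open>Induction on the largest point \<open>b\<close>: the height over the earlier points is a
  function of their sets alone, hence independent of \<open>Y b\<close>.\<close>

lemma distr_selection_height:
  assumes ind: "indep_vars (\<lambda>_. fell_borel) Y X"
    and stat: "\<And>x. x \<in> X \<Longrightarrow> first_order_stationary M (Y x)"
    and "finite F" "F \<subseteq> X"
  shows "distr M borel (\<lambda>w. selection_height t (\<lambda>x. Y x w) F)
    = distr M borel (\<lambda>w. \<Sum>x\<in>F. dist_right_of_zero (Y x w))"
  using assms(3,4)
proof (induction F rule: finite_linorder_max_induct)
  case empty
  then show ?case by simp
next
  case (insert b F)
  have FX: "F \<subseteq> X" "{b} \<subseteq> X" "F \<inter> {b} = {}"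
    using insert.prems insert.hyps by auto
  have rv [measurable]: "Y x \<in> M \<rightarrow>\<^sub>M fell_borel" if "x \<in> insert b F" for x
    using ind insert.prems that unfolding indep_vars_def by auto
  \<comment> \<open>Stated for general \<open>h\<close> because it serves both the greedy height and
    the partial sum. The assumption \<open>cong\<close> lets \<open>h\<close> factor through the
    restriction to \<open>F\<close>, and the projection \<open>z b\<close> recovers
    \<open>Y b\<close> from the family over \<open>{b}\<close>.\<close>
  have joint: "distr M (borel \<Otimes>\<^sub>M fell_borel) (\<lambda>w. (h (\<lambda>x. Y x w), Y b w))
      = distr M borel (\<lambda>w. h (\<lambda>x. Y x w)) \<Otimes>\<^sub>M distr M fell_borel (Y b)"
    if h: "h \<in> borel_measurable (PiM F (\<lambda>_. fell_borel))"
      and cong: "\<And>A B. (\<And>x. x \<in> F \<Longrightarrow> A x = B x) \<Longrightarrow> h A = h B" for h :: "_ \<Rightarrow> ennreal"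
  proof -
    have "h (\<lambda>x\<in>F. Y x w) = h (\<lambda>x. Y x w)" for w
      by (rule cong) simp
    then show ?thesis
      using distr_pair_indep_compose[OF indep_var_restrict[OF ind FX(3,1,2)] h, of "\<lambda>z. z b" fell_borel]
      by simp
  qed
  have "distr M borel (\<lambda>w. selection_height t (\<lambda>x. Y x w) (insert b F))
      = distr M borel (\<lambda>w. next_dist t (Y b w) (selection_height t (\<lambda>x. Y x w) F))"
    using insert.hyps by (simp add: selection_height_insert_max)
  also have "\<dots> = distr M borel (\<lambda>w. (\<Sum>x\<in>F. dist_right_of_zero (Y x w)) + dist_right_of_zero (Y b w))"
  proof (rule distr_next_dist_indep)
    show "distr M (borel \<Otimes>\<^sub>M fell_borel) (\<lambda>w. (selection_height t (\<lambda>x. Y x w) F, Y b w))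
        = distr M borel (\<lambda>w. selection_height t (\<lambda>x. Y x w) F) \<Otimes>\<^sub>M distr M fell_borel (Y b)"
      using insert.hyps
      by (intro joint[of "\<lambda>z. selection_height t z F"] measurable_selection_height[of F "\<lambda>x z. z x"])
        (auto intro: selection_height_cong)
    show "distr M (borel \<Otimes>\<^sub>M fell_borel) (\<lambda>w. ((\<Sum>x\<in>F. dist_right_of_zero (Y x w)), Y b w))
        = distr M borel (\<lambda>w. \<Sum>x\<in>F. dist_right_of_zero (Y x w)) \<Otimes>\<^sub>M distr M fell_borel (Y b)"
      by (intro joint[of "\<lambda>z. \<Sum>x\<in>F. dist_right_of_zero (z x)"]) (auto intro!: sum.cong)
    show "first_order_stationary M (Y b)"
      using stat FX by blast
    show "(\<lambda>w. selection_height t (\<lambda>x. Y x w) F) \<in> borel_measurable M"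
      using insert.hyps rv by (intro measurable_selection_height) auto
    show "distr M borel (\<lambda>w. selection_height t (\<lambda>x. Y x w) F)
        = distr M borel (\<lambda>w. \<Sum>x\<in>F. dist_right_of_zero (Y x w))"
      using insert.IH FX by blast
  qed measurable
  also have "(\<lambda>w. (\<Sum>x\<in>F. dist_right_of_zero (Y x w)) + dist_right_of_zero (Y b w))
      = (\<lambda>w. \<Sum>x\<in>insert b F. dist_right_of_zero (Y x w))"
    using insert.hyps by (subst sum.insert) (auto simp: add.commute)
  finally show ?case .
qed

text \<open>For increasing sequences the laws of the single terms determine that of the supremum:
  \<open>SUP \<le> u\<close> is a decreasing intersection, so continuity from above applies.\<close>

lemma distr_SUP_eq:
  fixes U V :: "nat \<Rightarrow> 'a \<Rightarrow> ennreal"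
  assumes U [measurable]: "\<And>n. U n \<in> borel_measurable M" and V [measurable]: "\<And>n. V n \<in> borel_measurable M"
    and "\<And>w. incseq (\<lambda>n. U n w)" "\<And>w. incseq (\<lambda>n. V n w)"
    and law: "\<And>n. distr M borel (U n) = distr M borel (V n)"
  shows "distr M borel (\<lambda>w. SUP n. U n w) = distr M borel (\<lambda>w. SUP n. V n w)"
proof (rule measure_ennreal_eqI_atMost)
  show "finite_measure (distr M borel (\<lambda>w. SUP n. U n w))"
    by (intro finite_measure_distr) measurable
  fix u :: ennreal
  have cdf: "emeasure (distr M borel (\<lambda>w. SUP n. W n w)) {..u} = (INF n. emeasure (distr M borel (W n)) {..u})"
    if [measurable]: "\<And>n. W n \<in> borel_measurable M" and inc: "\<And>w. incseq (\<lambda>n. W n w)"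
    for W :: "nat \<Rightarrow> 'a \<Rightarrow> ennreal"
  proof -
    have "emeasure (distr M borel (\<lambda>w. SUP n. W n w)) {..u} = emeasure M (\<Inter>n. {w \<in> space M. W n w \<le> u})"
      by (auto simp: emeasure_distr SUP_le_iff intro!: arg_cong[where f = "emeasure M"])
    also have "\<dots> = (INF n. emeasure M {w \<in> space M. W n w \<le> u})"
    proof (rule INF_emeasure_decseq[symmetric])
      show "decseq (\<lambda>n. {w \<in> space M. W n w \<le> u})"
        using inc by (intro decseq_SucI) (auto intro: order_trans dest: incseq_SucD)
    qed (auto simp: emeasure_eq_measure)
    also have "\<dots> = (INF n. emeasure (distr M borel (W n)) {..u})"
      by (simp add: emeasure_distr vimage_def Int_def conj_commute)
    finally show ?thesis .
  qed
  show "emeasure (distr M borel (\<lambda>w. SUP n. U n w)) {..u} = emeasure (distr M borel (\<lambda>w. SUP n. V n w)) {..u}"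
    using assms by (simp add: cdf)
qed simp_all

section \<open>The zero-one law\<close>

text \<open>Carries independence from the index set \<open>X\<close> of reals over to the naturals,
  where Kolmogorov's law applies.\<close>

lemma indep_sets_reindex:
  assumes ind: "indep_sets F X" and inj: "inj_on e J" and sub: "e ` J \<subseteq> X"
  shows "indep_sets (\<lambda>i. F (e i)) J"
  unfolding indep_sets_def
proof (intro conjI ballI allI impI)
  show "F (e i) \<subseteq> events" if "i \<in> J" for i
    using ind sub that unfolding indep_sets_def by auto
  fix K A assume K: "K \<subseteq> J" "K \<noteq> {}" "finite K" and A: "A \<in> (\<Pi> i\<in>K. F (e i))"
  define B where "B x = A (inv_into K e x)" for x
  have injK: "inj_on e K" using inj K(1) by (rule inj_on_subset)
  have B: "B (e i) = A i" if "i \<in> K" for i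
    unfolding B_def using injK that by simp
  have "prob (\<Inter>x\<in>e ` K. B x) = (\<Prod>x\<in>e ` K. prob (B x))"
  proof (rule indep_setsD[OF ind])
    show "\<forall>x\<in>e ` K. B x \<in> F x"
      using A B by auto
  qed (use K sub in auto)
  then show "prob (\<Inter>i\<in>K. A i) = (\<Prod>i\<in>K. prob (A i))"
    using B by (simp add: prod.reindex[OF injK])
qed

text \<open>Dropping finitely many finite terms does not affect convergence, so the event is a tail
  event.\<close>

lemma zero_one_suminf_finite:
  fixes D :: "nat \<Rightarrow> 'a \<Rightarrow> ennreal"
  assumes ind: "indep_vars (\<lambda>_. borel) D UNIV" and fin: "\<And>n. AE w in M. D n w < \<infinity>"
  shows "prob {w \<in> space M. (\<Sum>n. D n w) < \<infinity>} = 0 \<or> prob {w \<in> space M. (\<Sum>n. D n w) < \<infinity>} = 1"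
proof -
  have [measurable]: "D n \<in> borel_measurable M" for n
    using ind unfolding indep_vars_def by auto
  \<comment> \<open>Finite summands are needed for the event to lie in the tail sigma-algebra.\<close>
  define E where "E n w = (if D n w = \<infinity> then 0 else D n w)" for n w
  have indE: "indep_vars (\<lambda>_. borel) E UNIV"
    unfolding E_def by (rule indep_vars_compose2[OF ind, where Y = "\<lambda>_ d. if d = \<infinity> then 0 else d"]) measurable
  have [measurable]: "E n \<in> borel_measurable M" for n
    unfolding E_def by measurable
  define T where "T = {w \<in> space M. (\<Sum>n. E n w) < \<infinity>}"
  define A where "A i = sigma_sets (space M) {E i -` B \<inter> space M | B. B \<in> sets borel}" for i
  have "prob T = 0 \<or> prob T = 1"
  proof (rule kolmogorov_0_1_law)
    show "sigma_algebra (space M) (A i)" for i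
      unfolding A_def by (rule sigma_algebra_sigma_sets) auto
    show "indep_sets A UNIV"
      using indE unfolding indep_vars_def A_def by simp
    have "T \<in> sigma_sets (space M) (\<Union>i\<in>{m..}. A i)" for m
    proof -
      \<comment> \<open>The sigma-algebra of the terms from index \<open>m\<close> on, packaged as a
        measure so that measurability of the shifted series can be derived over it.\<close>
      define N where "N = sigma (space M) (\<Union>i\<in>{m..}. A i)"
      have A_sub: "A i \<subseteq> Pow (space M)" for i
      proof (intro subsetI PowI)
        fix B w assume "B \<in> A i" "w \<in> B"
        then show "w \<in> space M"
          using sigma_sets_into_sp[of "{E i -` B \<inter> space M | B. B \<in> sets borel}" "space M" B]
          unfolding A_def by auto
      qed
      have N: "space N = space M" "sets N = sigma_sets (space M) (\<Union>i\<in>{m..}. A i)"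
        unfolding N_def using A_sub by (auto intro!: space_measure_of sets_measure_of)
      have [measurable]: "E (n + m) \<in> borel_measurable N" for n
      proof (rule measurableI)
        fix B :: "ennreal set" assume "B \<in> sets borel"
        then have "E (n + m) -` B \<inter> space M \<in> A (n + m)"
          unfolding A_def by blast
        then show "E (n + m) -` B \<inter> space N \<in> sets N"
          unfolding N by (intro sigma_sets.Basic) auto
      qed simp
      have "(\<Sum>n. E n w) < \<infinity> \<longleftrightarrow> (\<Sum>n. E (n + m) w) < \<infinity>" for w
        by (subst suminf_offset[of "\<lambda>n. E n w" m]) (auto simp: E_def less_top)
      then have "T = {w \<in> space N. (\<Sum>n. E (n + m) w) < \<infinity>}"
        unfolding T_def N by simp
      also have "\<dots> \<in> sets N"
        by measurable
      finally show ?thesis unfolding N .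
    qed
    then show "T \<in> tail_events A"
      unfolding tail_events_def by simp
  qed
  moreover have "prob {w \<in> space M. (\<Sum>n. D n w) < \<infinity>} = prob T"
  proof (rule finite_measure_eq_AE)
    have "AE w in M. \<forall>n. D n w < \<infinity>"
      using fin by (simp add: AE_all_countable)
    then show "AE w in M. w \<in> {w \<in> space M. (\<Sum>n. D n w) < \<infinity>} \<longleftrightarrow> w \<in> T"
    proof eventually_elim
      case (elim w)
      then have "D n w = E n w" for n
        by (auto simp: E_def less_top)
      then show ?case
        unfolding T_def by simp
    qed
  qed (unfold T_def, measurable)
  ultimately show ?thesis by simp
qed

text \<open>By stationarity \<open>{-n..n}\<close> is hit as often as \<open>{0..2n}\<close>, and a
  hit of the latter makes the distance finite. As \<open>n\<close> grows, the former probability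
  tends to that of \<open>Y\<close> being nonempty, which is 1.\<close>

lemma AE_dist_right_of_zero_finite:
  assumes Y [measurable]: "Y \<in> M \<rightarrow>\<^sub>M fell_borel"
    and ne: "prob {w \<in> space M. Y w = {}} = 0"
    and stat: "first_order_stationary M Y"
  shows "AE w in M. dist_right_of_zero (Y w) < \<infinity>"
proof -
  define G where "G a b = {w \<in> space M. Y w \<inter> {a..b} \<noteq> {}}" for a b :: real
  have G [measurable]: "G a b \<in> events" for a b
  proof -
    have "G a b = Y -` {F. closed F \<and> F \<inter> {a..b} \<noteq> {}} \<inter> space M"
      unfolding G_def using closed_if_measurable_fell_borel[OF Y] by auto
    then show ?thesis
      using measurable_sets[OF Y fell_borel_hit_compact[OF compact_Icc]] by simp
  qed
  have union: "(\<Union>n. G (- real n) (real n)) = space M - {w \<in> space M. Y w = {}}"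
  proof (intro equalityI subsetI)
    fix w assume "w \<in> space M - {w \<in> space M. Y w = {}}"
    then obtain y where y: "w \<in> space M" "y \<in> Y w" by auto
    obtain n :: nat where "\<bar>y\<bar> \<le> real n" using real_arch_simple by blast
    then show "w \<in> (\<Union>n. G (- real n) (real n))"
      using y by (auto simp: G_def abs_le_iff intro!: exI[of _ n] bexI[of _ y])
  qed (auto simp: G_def)
  \<comment> \<open>A set outside the sigma-algebra would also have \<open>prob\<close> 0, so
    measurability is secured before complements are taken.\<close>
  have "{w \<in> space M. Y w = {}} = space M - (\<Union>n. G (- real n) (real n))"
    unfolding union by auto
  then have [measurable]: "{w \<in> space M. Y w = {}} \<in> events"
    by simp
  have "prob (G (- real n) (real n)) \<le> prob {w \<in> space M. dist_right_of_zero (Y w) < \<infinity>}" for n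
  proof -
    have "prob (G (- real n) (real n)) = prob (G 0 (2 * real n))"
      unfolding G_def
      using stat[unfolded first_order_stationary_def, rule_format, of 0 "2 * real n" "- real n"] by simp
    also have "\<dots> \<le> prob {w \<in> space M. dist_right_of_zero (Y w) < \<infinity>}"
    proof (rule finite_measure_mono)
      show "G 0 (2 * real n) \<subseteq> {w \<in> space M. dist_right_of_zero (Y w) < \<infinity>}"
      proof
        fix w assume "w \<in> G 0 (2 * real n)"
        then obtain y where y: "w \<in> space M" "y \<in> Y w" "0 \<le> y"
          unfolding G_def by auto
        then have "dist_right_of_zero (Y w) \<le> ennreal (y - 0)"
          unfolding dist_right_of_zero_eq_next_dist by (intro next_dist_le) auto
        also have "\<dots> < \<infinity>" by simp
        finally show "w \<in> {w \<in> space M. dist_right_of_zero (Y w) < \<infinity>}"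
          using y by simp
      qed
    qed measurable
    finally show ?thesis .
  qed
  moreover have "(\<lambda>n. prob (G (- real n) (real n))) \<longlonglongrightarrow> prob (\<Union>n. G (- real n) (real n))"
  proof (rule finite_Lim_measure_incseq)
    show "incseq (\<lambda>n. G (- real n) (real n))"
      unfolding G_def by (intro incseq_SucI) fastforce
  qed (use G in auto)
  ultimately have "prob (\<Union>n. G (- real n) (real n)) \<le> prob {w \<in> space M. dist_right_of_zero (Y w) < \<infinity>}"
    by (intro LIMSEQ_le_const2) auto
  moreover have "prob (\<Union>n. G (- real n) (real n)) = 1"
    unfolding union using ne by (subst prob_compl) auto
  ultimately have "prob {w \<in> space M. dist_right_of_zero (Y w) < \<infinity>} = 1"
    by (simp add: measure_ge_1_iff)
  then have "AE w in M. w \<in> {w \<in> space M. dist_right_of_zero (Y w) < \<infinity>}"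
    by (intro AE_prob_1)
  then show ?thesis by eventually_elim simp
qed

end

section \<open>Assembly along an enumeration of the index set\<close>

theorem theorem6:
  fixes P :: "'w measure"
    and X :: "real set"
    and Y :: "real \<Rightarrow> 'w \<Rightarrow> real set"
  assumes "prob_space P" and "complete_measure P"
    and "countable X" and "infinite X"
    and "\<And>x. x \<in> X \<Longrightarrow> Y x \<in> P \<rightarrow>\<^sub>M fell_borel"
    and "prob_space.indep_vars P (\<lambda>_. fell_borel) Y X"
    and "\<And>x. x \<in> X \<Longrightarrow> measure P {w \<in> space P. Y x w = {}} = 0"
    and "\<And>x. x \<in> X \<Longrightarrow> first_order_stationary P (Y x)"
  shows "let M = bounded_increasing_selection_event P X Y in
    M \<in> sets P
    \<and> ((AE w in P. (\<Sum>\<^sub>\<infinity>x\<in>X. dist_right_of_zero (Y x w)) < \<infinity>) \<longrightarrow> measure P M = 1)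
    \<and> (\<not> (AE w in P. (\<Sum>\<^sub>\<infinity>x\<in>X. dist_right_of_zero (Y x w)) < \<infinity>) \<longrightarrow> measure P M = 0)"
proof -
  interpret prob_space P by fact
  note Y [measurable] = assms(5) and ind = assms(6) and ne = assms(7) and stat = assms(8)
  obtain e :: "nat \<Rightarrow> real" where e: "bij_betw e UNIV X"
    using assms(3,4) by (metis bij_betw_from_nat_into)
  have inj: "inj e" and eX: "e i \<in> X" for i
    using e unfolding bij_betw_def by auto
  have Ye [measurable]: "Y (e i) \<in> P \<rightarrow>\<^sub>M fell_borel" for i
    using Y[OF eX] .
  define F where "F n = e ` {..<n}" for n
  have F: "X = (\<Union>n. F n)" "incseq F" "\<And>n. finite (F n)" "\<And>n. F n \<subseteq> X"
    using e unfolding F_def bij_betw_def incseq_def by auto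
  define S where "S w = (\<Sum>\<^sub>\<infinity>x\<in>X. dist_right_of_zero (Y x w))" for w
  have S_suminf: "S w = (\<Sum>n. dist_right_of_zero (Y (e n) w))" for w
  proof -
    have "S w = (\<Sum>\<^sub>\<infinity>n. dist_right_of_zero (Y (e n) w))"
      unfolding S_def by (rule infsum_reindex_bij_betw[OF e, symmetric])
    also have "\<dots> = (\<Sum>n. dist_right_of_zero (Y (e n) w))"
      by (intro sums_unique has_sum_imp_sums has_sum_infsum nonneg_summable_on_complete) simp
    finally show ?thesis .
  qed
  have S_measurable [measurable]: "S \<in> borel_measurable P"
    unfolding S_suminf[abs_def] by measurable
  define Z where "Z k w = (SUP n. selection_height (- real k) (\<lambda>x. Y x w) (F n))" for k :: nat and w
  have height [measurable]: "(\<lambda>w. selection_height t (\<lambda>x. Y x w) (F n)) \<in> borel_measurable P" for t n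
    using F(3,4) Y by (intro measurable_selection_height) blast+
  have Z_measurable [measurable]: "Z k \<in> borel_measurable P" for k
    unfolding Z_def by measurable
  \<comment> \<open>At each finite stage the two laws agree, and both sides increase with
    \<open>n\<close>; the limit law does not depend on the start \<open>- real k\<close>.\<close>
  have law: "distr P borel (Z k) = distr P borel S" for k
  proof -
    have "distr P borel (Z k) = distr P borel (\<lambda>w. SUP n. \<Sum>x\<in>F n. dist_right_of_zero (Y x w))"
      unfolding Z_def[abs_def]
    proof (rule distr_SUP_eq)
      show "incseq (\<lambda>n. selection_height (- real k) (\<lambda>x. Y x w) (F n))" for w
        using F by (intro incseq_SucI selection_height_mono) (auto dest: incseq_SucD)
      show "incseq (\<lambda>n. \<Sum>x\<in>F n. dist_right_of_zero (Y x w))" for w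
        using F by (intro incseq_SucI sum_mono2) (auto dest: incseq_SucD)
      show "(\<lambda>w. \<Sum>x\<in>F n. dist_right_of_zero (Y x w)) \<in> borel_measurable P" for n
        unfolding F_def by (subst sum.reindex) (auto intro: inj_on_subset[OF inj] simp: comp_def)
    qed (use height distr_selection_height[OF ind stat F(3,4)] in auto)
    also have "(\<lambda>w. SUP n. \<Sum>x\<in>F n. dist_right_of_zero (Y x w)) = S"
      unfolding S_suminf suminf_eq_SUP F_def
      by (subst sum.reindex) (auto intro: inj_on_subset[OF inj] simp: comp_def)
    finally show ?thesis .
  qed
  have prob_Z: "prob {w \<in> space P. Z k w < \<infinity>} = prob {w \<in> space P. S w < \<infinity>}" for k
    using arg_cong[OF law, of "\<lambda>N. measure N {..<\<infinity>}" k]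
    by (simp add: measure_distr vimage_def Int_def conj_commute)
  define M where "M = bounded_increasing_selection_event P X Y"
  have "(\<exists>f :: real \<Rightarrow> real. mono f \<and> bounded (range f) \<and> (\<forall>x\<in>X. f x \<in> Y x w)) \<longleftrightarrow>
      (\<exists>k. Z k w < \<infinity>)" if "w \<in> space P" for w
    unfolding Z_def using F(1-3) closed_if_measurable_fell_borel[OF Y that]
    by (rule bounded_increasing_selection_iff)
  \<comment> \<open>The selection event is a countable union of measurable events, which gives its
    measurability and reduces both probabilities to those of the events for single
    \<open>k\<close>.\<close>
  then have M_eq: "M = (\<Union>k. {w \<in> space P. Z k w < \<infinity>})"
    unfolding M_def bounded_increasing_selection_event_def by (auto cong: conj_cong)
  have M: "M \<in> events"
    unfolding M_eq by measurable
  have AE_iff: "(AE w in P. S w < \<infinity>) \<longleftrightarrow> prob {w \<in> space P. S w < \<infinity>} = 1"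
    by (subst prob_Collect_eq_1) auto
  have one: "prob M = 1" if "AE w in P. S w < \<infinity>"
  proof -
    \<comment> \<open>The single start at 0 already gives full probability.\<close>
    have "1 = prob {w \<in> space P. Z 0 w < \<infinity>}"
      using that unfolding AE_iff prob_Z by simp
    also have "\<dots> \<le> prob M"
      using M by (intro finite_measure_mono) (auto simp: M_eq)
    finally show ?thesis by (simp add: measure_ge_1_iff)
  qed
  have zero: "prob M = 0" if "\<not> (AE w in P. S w < \<infinity>)"
  proof -
    have "indep_vars (\<lambda>_. fell_borel) (\<lambda>i. Y (e i)) UNIV"
      using ind eX indep_sets_reindex[OF _ inj] unfolding indep_vars_def by (auto simp: image_subset_iff)
    then have "indep_vars (\<lambda>_. borel) (\<lambda>i w. dist_right_of_zero (Y (e i) w)) UNIV"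
      by (rule indep_vars_compose2) measurable
    then have "prob {w \<in> space P. S w < \<infinity>} = 0 \<or> prob {w \<in> space P. S w < \<infinity>} = 1"
      unfolding S_suminf
      by (rule zero_one_suminf_finite) (intro AE_dist_right_of_zero_finite Ye ne stat eX)
    \<comment> \<open>Failure of almost sure convergence excludes probability 1, so the zero-one law
      makes the event for each \<open>k\<close> null.\<close>
    then have "prob {w \<in> space P. Z k w < \<infinity>} = 0" for k
      using that unfolding AE_iff prob_Z by simp
    then have "{w \<in> space P. Z k w < \<infinity>} \<in> null_sets P" for k
      by (auto simp: null_sets_def emeasure_eq_measure)
    then have "M \<in> null_sets P"
      unfolding M_eq by (intro null_sets_UN) auto
    then show ?thesis
      by (simp add: null_sets_def emeasure_eq_measure)
  qed
  show ?thesis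
    using M one zero unfolding M_def S_def by (simp add: Let_def)
qed

end
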